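(* Let $M$ be a nontrivial abelian group. There are only trivial dualities in the order $\preccurlyeq_M$: if $t\ge1$ and $F_1,\dots,F_t,H$ are graphs such that for every graph $G$ $$G\preccurlyeq_M H\iff F_i\not\preccurlyeq_M G\ \text{ for all } i\in\{1,\dots,t\},$$ then $H\approx_M K_1$ and $F_i\approx_M \overrightarrow{K}_2$ for some $i\in\{1,\dots,t\}$.
   Context: Graphs are finite directed graphs. For a circuit $C$ of the underlying undirected graph, $C^+$ and $C^-$ denote the sets of its edges oriented in each of the two directions around $C$. An $M$-tension on $G$ is a function $\tau:E(G)\to M$ such that $\sum_{e\in C^+}\tau(e)=\sum_{e\in C^-}\tau(e)$ for every circuit $C$ of $G$. A mapping $f:E(G)\to E(H)$ is $M$-tension-continuous if for every $M$-tension $\tau$ on $H$ the composition $\tau\circ f$ is an $M$-tension on $G$. Write $G\preccurlyeq_M H$ if there is an $M$-tension-continuous mapping $E(G)\to E(H)$, and $G\approx_M H$ if $G\preccurlyeq_M H$ and $H\preccurlyeq_M G$. $K_1$ is the one-vertex graph without edges, and $\overrightarrow{K}_2$ is the directed graph with two vertices and a single directed edge. *)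

theory Defs
  imports "Graph_Theory.Graph_Theory"
begin

text \<open>
  A finite directed graph is a \<^locale>\<open>fin_digraph\<close>: loops and parallel arcs are allowed.

  In the next digraph, every arc \<open>e\<close> of \<open>G\<close> occurs as \<open>(e, True)\<close>, traversed from tail to head,
  and as \<open>(e, False)\<close>, traversed from head to tail.
\<close>

definition traversals :: "('a, 'b) pre_digraph \<Rightarrow> ('a, 'b \<times> bool) pre_digraph" where
  "traversals G =
     \<lparr> verts = verts G,
       arcs = arcs G \<times> UNIV,
       tail = (\<lambda>(e, fwd). if fwd then tail G e else head G e),
       head = (\<lambda>(e, fwd). if fwd then head G e else tail G e) \<rparr>"

text \<open>
  A circuit of the underlying undirected graph, listed with a direction of traversal. Distinctness
  of the underlying arcs excludes going back and forth along a single arc. A loop is a circuit of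
  length 1, and two arcs with the same two ends form a circuit of length 2.
\<close>

definition circuit :: "('a, 'b) pre_digraph \<Rightarrow> ('b \<times> bool) list \<Rightarrow> bool" where
  "circuit G C \<longleftrightarrow> pre_digraph.cycle (traversals G) C \<and> distinct (map fst C)"

definition circuit_pos :: "('b \<times> bool) list \<Rightarrow> 'b set" where
  "circuit_pos C = {e. (e, True) \<in> set C}"

definition circuit_neg :: "('b \<times> bool) list \<Rightarrow> 'b set" where
  "circuit_neg C = {e. (e, False) \<in> set C}"

text \<open>
  Below, functions on the arc set are total functions on the arc type; their values outside the
  arc set play no role.
\<close>

definition tension :: "('a, 'b) pre_digraph \<Rightarrow> ('b \<Rightarrow> 'm::ab_group_add) \<Rightarrow> bool" where
  "tension G \<tau> \<longleftrightarrow>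
     (\<forall>C. circuit G C \<longrightarrow> (\<Sum>e\<in>circuit_pos C. \<tau> e) = (\<Sum>e\<in>circuit_neg C. \<tau> e))"

definition tension_continuous ::
  "'m::ab_group_add itself \<Rightarrow> ('a, 'b) pre_digraph \<Rightarrow> ('c, 'd) pre_digraph \<Rightarrow> ('b \<Rightarrow> 'd) \<Rightarrow> bool"
where
  "tension_continuous _ G H f \<longleftrightarrow>
     f \<in> arcs G \<rightarrow> arcs H \<and> (\<forall>\<tau> :: 'd \<Rightarrow> 'm. tension H \<tau> \<longrightarrow> tension G (\<tau> \<circ> f))"

definition tension_le ::
  "'m::ab_group_add itself \<Rightarrow> ('a, 'b) pre_digraph \<Rightarrow> ('c, 'd) pre_digraph \<Rightarrow> bool"
where
  "tension_le M G H \<longleftrightarrow> (\<exists>f. tension_continuous M G H f)"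

definition tension_equiv ::
  "'m::ab_group_add itself \<Rightarrow> ('a, 'b) pre_digraph \<Rightarrow> ('c, 'd) pre_digraph \<Rightarrow> bool"
where
  "tension_equiv M G H \<longleftrightarrow> tension_le M G H \<and> tension_le M H G"

definition graph_K1 :: "(nat, nat) pre_digraph" where
  "graph_K1 = \<lparr> verts = {0}, arcs = {}, tail = (\<lambda>_. 0), head = (\<lambda>_. 0) \<rparr>"

definition graph_K2 :: "(nat, nat) pre_digraph" where
  "graph_K2 = \<lparr> verts = {0, 1}, arcs = {0}, tail = (\<lambda>_. 0), head = (\<lambda>_. 1) \<rparr>"

end

theory Submission
  imports Defs "HOL-Library.FuncSet" Complex_Main
begin

text \<open>
  If \<open>H\<close> has an arc, then no \<open>F i\<close> maps to \<open>graph_K2\<close>, because \<open>graph_K2\<close> maps to \<open>H\<close>. Take a graph \<open>G\<close>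
  whose girth exceeds the number of arcs of every \<open>F i\<close>. The image of a map \<open>F i \<rightarrow> G\<close> spans a
  forest, on which constant functions extend to tensions of \<open>G\<close>, so \<open>F i\<close> would map to \<open>graph_K2\<close>.
  Hence no \<open>F i\<close> maps to \<open>G\<close>, and \<open>G\<close> maps to \<open>H\<close>. But \<open>H\<close> is loopless, so pulling back one cut
  for each vertex of \<open>H\<close> yields potentials that colour \<open>G\<close> properly with \<open>3 ^ card (verts H)\<close>
  colours. This fails if \<open>G\<close> has large chromatic number besides large girth.

  Such a \<open>G\<close> is found by counting maps from \<open>D * n\<close> arcs to pairs of vertices in \<open>{..<n}\<close>, with \<open>D\<close>
  constant: the average number of short circuits is bounded independently of \<open>n\<close>, whereas few
  maps admit a colouring with boundedly many monochromatic arcs.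
\<close>

section \<open>Tensions and potentials\<close>

lemma traversals_simps [simp]:
  "verts (traversals G) = verts G"
  "arcs (traversals G) = arcs G \<times> UNIV"
  "tail (traversals G) (e, b) = (if b then tail G e else head G e)"
  "head (traversals G) (e, b) = (if b then head G e else tail G e)"
  by (simp_all add: traversals_def)

lemma wf_digraph_traversals: "wf_digraph G \<Longrightarrow> wf_digraph (traversals G)"
  by (auto simp: wf_digraph_def)

text \<open>Unlike the two sums over sets, this list form can be evaluated by induction along any
  walk, closed or not.\<close>

definition signed_sum :: "('b \<Rightarrow> 'm::ab_group_add) \<Rightarrow> ('b \<times> bool) list \<Rightarrow> 'm" where
  "signed_sum \<tau> C = (\<Sum>(e, fwd)\<leftarrow>C. if fwd then \<tau> e else - \<tau> e)"

lemma signed_sum_simps [simp]: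
  "signed_sum \<tau> [] = 0"
  "signed_sum \<tau> ((e, b) # C) = (if b then \<tau> e else - \<tau> e) + signed_sum \<tau> C"
  by (simp_all add: signed_sum_def)

lemma finite_circuit_pos_neg [simp]: "finite (circuit_pos C)" "finite (circuit_neg C)"
proof -
  have "circuit_pos C \<subseteq> fst ` set C" "circuit_neg C \<subseteq> fst ` set C"
    by (force simp: circuit_pos_def circuit_neg_def)+
  then show "finite (circuit_pos C)" "finite (circuit_neg C)"
    by (simp_all add: finite_subset)
qed

lemma circuit_pos_neg_simps [simp]:
  "circuit_pos [] = {}" "circuit_neg [] = {}"
  "circuit_pos ((e, b) # C) = (if b then insert e (circuit_pos C) else circuit_pos C)"
  "circuit_neg ((e, b) # C) = (if b then circuit_neg C else insert e (circuit_neg C))"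
  by (auto simp: circuit_pos_def circuit_neg_def)

text \<open>Without repeated arcs, each step of the induction adds a new element to one of the two
  sets, so no term is lost.\<close>

lemma signed_sum_circuit:
  fixes \<tau> :: "'b \<Rightarrow> 'm::ab_group_add"
  assumes "distinct (map fst C)"
  shows "signed_sum \<tau> C = sum \<tau> (circuit_pos C) - sum \<tau> (circuit_neg C)"
  using assms
proof (induction C)
  case (Cons a C)
  obtain e b where a: "a = (e, b)" by force
  have "e \<notin> circuit_pos C" "e \<notin> circuit_neg C"
    using Cons.prems a by (force simp: circuit_pos_def circuit_neg_def)+
  then show ?case using Cons a by (simp add: algebra_simps)
qed simp

lemma tension_iff_signed_sum:
  "tension G \<tau> \<longleftrightarrow> (\<forall>C. circuit G C \<longrightarrow> signed_sum \<tau> C = 0)"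
proof -
  have "signed_sum \<tau> C = 0 \<longleftrightarrow> sum \<tau> (circuit_pos C) = sum \<tau> (circuit_neg C)"
    if "circuit G C" for C
    using that signed_sum_circuit[of C \<tau>] by (simp add: circuit_def)
  then show ?thesis unfolding tension_def by blast
qed

lemma circuit_arcs:
  assumes "circuit G C" "(e, b) \<in> set C"
  shows "e \<in> arcs G"
  using assms by (auto simp: circuit_def pre_digraph.cycle_def pre_digraph.awalk_def)

lemma circuit_nonempty: "circuit G C \<Longrightarrow> C \<noteq> []"
  by (auto simp: circuit_def pre_digraph.cycle_def)

lemma signed_sum_cong:
  assumes "\<And>e b. (e, b) \<in> set C \<Longrightarrow> \<sigma> e = \<tau> e"
  shows "signed_sum \<sigma> C = signed_sum \<tau> C"
  unfolding signed_sum_def by (rule arg_cong[of _ _ sum_list], rule map_cong) (use assms in auto)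

lemma tension_cong:
  assumes "\<And>e. e \<in> arcs G \<Longrightarrow> \<sigma> e = \<tau> e"
  shows "tension G \<sigma> \<longleftrightarrow> tension G \<tau>"
proof -
  have "signed_sum \<sigma> C = signed_sum \<tau> C" if "circuit G C" for C
    by (rule signed_sum_cong) (use assms circuit_arcs[OF that] in blast)
  then show ?thesis by (simp add: tension_iff_signed_sum)
qed

lemma tension_zero: "tension G (\<lambda>_. 0)"
  by (simp add: tension_def)

lemma tension_loop:
  assumes "tension G \<tau>" "wf_digraph G" "e \<in> arcs G" "tail G e = head G e"
  shows "\<tau> e = 0"
proof -
  have "circuit G [(e, True)]"
    using assms by (auto simp: circuit_def pre_digraph.cycle_def pre_digraph.awalk_def
        pre_digraph.cas.simps pre_digraph.awalk_verts.simps wf_digraph_def)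
  then have "signed_sum \<tau> [(e, True)] = 0"
    using assms(1) unfolding tension_iff_signed_sum by blast
  then show ?thesis by simp
qed

definition potential_diff :: "('a, 'b) pre_digraph \<Rightarrow> ('a \<Rightarrow> 'm::ab_group_add) \<Rightarrow> 'b \<Rightarrow> 'm" where
  "potential_diff G p e = p (head G e) - p (tail G e)"

text \<open>Telescoping: a step in either direction contributes the potential at its end minus the
  potential at its start.\<close>

lemma signed_sum_walk:
  assumes "pre_digraph.cas (traversals G) u C v"
    and "\<And>e b. (e, b) \<in> set C \<Longrightarrow> \<tau> e = potential_diff G p e"
  shows "signed_sum \<tau> C = p v - p u"
  using assms
proof (induction C arbitrary: u)
  case Nil
  then show ?case by (simp add: pre_digraph.cas.simps)
next
  case (Cons a C)
  obtain e b where a: "a = (e, b)" by force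
  have "signed_sum \<tau> C = p v - p (head (traversals G) a)"
    by (rule Cons.IH) (use Cons.prems in \<open>auto simp: pre_digraph.cas.simps\<close>)
  moreover have "\<tau> e = potential_diff G p e" using Cons.prems a by auto
  moreover have "u = tail (traversals G) a"
    using Cons.prems by (simp add: pre_digraph.cas.simps)
  ultimately show ?case by (simp add: a potential_diff_def)
qed

lemma tension_potential_diff: "tension G (potential_diff G p)"
  unfolding tension_iff_signed_sum
proof (intro allI impI)
  fix C assume "circuit G C"
  then obtain u where "pre_digraph.cas (traversals G) u C u"
    by (auto simp: circuit_def pre_digraph.cycle_def pre_digraph.awalk_def)
  then show "signed_sum (potential_diff G p) C = 0"
    by (simp add: signed_sum_walk)
qed

section \<open>Restriction to a subset of the arcs\<close>

lemma tail_head_traversals_arcs_update [simp]: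
  "tail (traversals (G\<lparr>arcs := A\<rparr>)) = tail (traversals G)"
  "head (traversals (G\<lparr>arcs := A\<rparr>)) = head (traversals G)"
  by (auto simp: traversals_def fun_eq_iff)

lemma awalk_verts_traversals_arcs_update [simp]:
  "pre_digraph.awalk_verts (traversals (G\<lparr>arcs := A\<rparr>)) u C
    = pre_digraph.awalk_verts (traversals G) u C"
  by (induction C arbitrary: u) (simp_all add: pre_digraph.awalk_verts.simps)

lemma cas_traversals_arcs_update [simp]:
  "pre_digraph.cas (traversals (G\<lparr>arcs := A\<rparr>)) u C v
    \<longleftrightarrow> pre_digraph.cas (traversals G) u C v"
  by (induction C arbitrary: u) (simp_all add: pre_digraph.cas.simps)

lemma circuit_arcs_update:
  assumes "circuit (G\<lparr>arcs := A\<rparr>) C" "A \<subseteq> B"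
  shows "circuit (G\<lparr>arcs := B\<rparr>) C"
proof -
  obtain u where "u \<in> verts G" "set C \<subseteq> A \<times> UNIV" "pre_digraph.cas (traversals G) u C u"
    "distinct (tl (pre_digraph.awalk_verts (traversals G) u C))" "C \<noteq> []" "distinct (map fst C)"
    using assms(1) unfolding circuit_def pre_digraph.cycle_def pre_digraph.awalk_def by auto
  moreover from this have "set C \<subseteq> B \<times> UNIV" using assms(2) by blast
  ultimately show ?thesis
    unfolding circuit_def pre_digraph.cycle_def pre_digraph.awalk_def
    by (intro conjI exI[of _ u]) simp_all
qed

lemma tension_arcs_update:
  assumes "tension (G\<lparr>arcs := B\<rparr>) \<tau>" "A \<subseteq> B"
  shows "tension (G\<lparr>arcs := A\<rparr>) \<tau>"
  using assms(1) circuit_arcs_update[OF _ assms(2)] unfolding tension_def by blast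

text \<open>A later traversal of the first arc, in either direction, would put both its ends on the
  rest of the path. One of them is the starting vertex, which the path does not revisit.\<close>

lemma apath_traversals_distinct:
  assumes "wf_digraph G" "pre_digraph.apath (traversals G) u C v"
  shows "distinct (map fst C)"
  using assms(2)
proof (induction C arbitrary: u)
  case (Cons a C)
  interpret T: wf_digraph "traversals G" by (rule wf_digraph_traversals) fact
  obtain e b where a: "a = (e, b)" by force
  have P: "T.apath (head (traversals G) a) C v" 
    and N: "tail (traversals G) a \<notin> set (T.awalk_verts (head (traversals G) a) C)"
    using Cons.prems by (auto simp: T.apath_Cons_iff)
  have "e \<noteq> fst x" if "x \<in> set C" for x
  proof
    assume "e = fst x"
    then obtain b' where x: "x = (e, b')" by (metis prod.collapse)
    have "{tail (traversals G) x, head (traversals G) x}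
        \<subseteq> set (T.awalk_verts (head (traversals G) a) C)"
      using T.awalk_verts_arc1[OF that] T.awalk_verts_arc2[OF T.awalkI_apath[OF P] that] by blast
    moreover have "tail (traversals G) a \<in> {tail (traversals G) x, head (traversals G) x}"
      using x a by auto
    ultimately show False using N by blast
  qed
  then show ?case using Cons.IH[OF P] a by auto
qed simp

text \<open>The potential is built arc by arc. An arc that closes a circuit gets the right value
  from the tension condition; any other arc joins two components, one of which can be shifted by a
  constant. The set \<open>A\<close> will be either the whole arc set or an acyclic set of
  arcs.\<close>

lemma tension_potential:
  fixes \<tau> :: "'b \<Rightarrow> 'm::ab_group_add"
  assumes "wf_digraph G" "finite A" "A \<subseteq> arcs G" "tension (G\<lparr>arcs := A\<rparr>) \<tau>"
  shows "\<exists>p. \<forall>e\<in>A. \<tau> e = potential_diff G p e"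
  using assms(2-)
proof (induction A)
  case (insert e A)
  obtain p where p: "\<And>f. f \<in> A \<Longrightarrow> \<tau> f = potential_diff G p f"
    using insert.IH insert.prems tension_arcs_update[where B = "insert e A" and A = A] by blast
  have wf: "wf_digraph (G\<lparr>arcs := A\<rparr>)" using assms(1) insert.prems by (auto simp: wf_digraph_def)
  interpret T: wf_digraph "traversals (G\<lparr>arcs := A\<rparr>)" by (rule wf_digraph_traversals) fact
  define u v where "u = tail G e" and "v = head G e"
  have uv: "u \<in> verts G" "v \<in> verts G"
    using assms(1) insert.prems by (auto simp: u_def v_def wf_digraph_def)
  \<comment> \<open>The component of the head of \<open>e\<close> before \<open>e\<close> is
    added.\<close>
  define X where "X = {w. \<exists>C. T.awalk v C w}"
  show ?case
  proof (cases "u \<in> X")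
    case True
    then obtain C where C: "T.apath v C u"
      using T.apath_awalk_to_apath unfolding X_def by blast
    have "set C \<subseteq> A \<times> UNIV" and cas: "pre_digraph.cas (traversals G) v C u"
      and "distinct (T.awalk_verts v C)"
      using C by (auto simp: T.apath_def T.awalk_def)
    moreover have "distinct (map fst C)" using apath_traversals_distinct[OF wf C] .
    ultimately have "circuit (G\<lparr>arcs := insert e A\<rparr>) ((e, True) # C)"
      using insert.hyps uv
      by (auto simp: circuit_def pre_digraph.cycle_def pre_digraph.awalk_def
        pre_digraph.cas.simps pre_digraph.awalk_verts.simps u_def v_def)
    then have "signed_sum \<tau> ((e, True) # C) = 0"
      using insert.prems unfolding tension_iff_signed_sum by blast
    moreover have "signed_sum \<tau> C = p u - p v"
      by (rule signed_sum_walk[OF cas p]) (use \<open>set C \<subseteq> A \<times> UNIV\<close> in auto)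
    ultimately have "\<tau> e = potential_diff G p e"
      by (simp add: potential_diff_def flip: u_def v_def) (metis add_eq_0_iff minus_diff_eq minus_minus)
    then show ?thesis using p by blast
  next
    case False
    \<comment> \<open>The error of \<open>p\<close> at \<open>e\<close>. Adding it on
      \<open>X\<close>, which contains \<open>v\<close> but not \<open>u\<close>, corrects
      \<open>e\<close>; no arc of \<open>A\<close> has exactly one end in \<open>X\<close>, so their
      values stay.\<close>
    define d where "d = \<tau> e - (p v - p u)"
    define p' where "p' = (\<lambda>w. if w \<in> X then p w + d else p w)"
    have step: "w' \<in> X" if "w \<in> X" "x \<in> A \<times> UNIV" "tail (traversals G) x = w"
      "head (traversals G) x = w'" for w w' x
    proof -
      obtain C where "T.awalk v C w" using \<open>w \<in> X\<close> X_def by blast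
      moreover have "T.awalk w [x] w'"
        using that T.arc_implies_awalk[of x] by (auto simp: split: if_splits)
      ultimately show ?thesis unfolding X_def using T.awalk_appendI by blast
    qed
    have "v \<in> X" unfolding X_def using uv by (auto intro: exI[of _ "[]"] simp: T.awalk_Nil_iff)
    then have "\<tau> e = potential_diff G p' e"
      using False by (simp add: potential_diff_def p'_def d_def flip: u_def v_def)
    moreover have "\<tau> f = potential_diff G p' f" if "f \<in> A" for f
    proof -
      have "tail G f \<in> X \<longleftrightarrow> head G f \<in> X"
        using step[of "tail G f" "(f, True)" "head G f"]
          step[of "head G f" "(f, False)" "tail G f"] that by (simp, blast)
      then have "potential_diff G p' f = potential_diff G p f"
        by (simp add: potential_diff_def p'_def)
      then show ?thesis using p[OF that] by simp
    qed
    ultimately show ?thesis by blast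
  qed
qed simp

section \<open>Large girth and large chromatic number\<close>

text \<open>Each arc independently chooses an ordered pair of tail and head, so counts factor over
  the arcs. Loops and parallel arcs may arise; they yield circuits of lengths 1 and 2.\<close>

definition arc_map_graph :: "nat \<Rightarrow> 'b set \<Rightarrow> ('b \<Rightarrow> nat \<times> nat) \<Rightarrow> (nat, 'b) pre_digraph" where
  "arc_map_graph n A \<phi> = \<lparr>verts = {..<n}, arcs = A, tail = fst \<circ> \<phi>, head = snd \<circ> \<phi>\<rparr>"

definition arc_maps :: "nat \<Rightarrow> 'b set \<Rightarrow> ('b \<Rightarrow> nat \<times> nat) set" where
  "arc_maps n A = A \<rightarrow>\<^sub>E {..<n} \<times> {..<n}"

lemma finite_arc_maps [simp]: "finite A \<Longrightarrow> finite (arc_maps n A)"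
  unfolding arc_maps_def by (intro finite_PiE) auto

lemma card_arc_maps: "finite A \<Longrightarrow> card (arc_maps n A) = (n ^ 2) ^ card A"
  by (simp add: arc_maps_def card_PiE card_cartesian_product power2_eq_square)

text \<open>The head of each step is the tail of the next one, and the head of the last step is the
  common end \<open>v\<close>.\<close>

lemma cas_eq_tails_imp_eq:
  assumes "pre_digraph.cas T u C v" "pre_digraph.cas T' u' C v"
    and "map (tail T) C = map (tail T') C" "x \<in> set C"
  shows "tail T x = tail T' x" "head T x = head T' x"
proof -
  show "tail T x = tail T' x" using assms by simp
  show "head T x = head T' x"
    using assms
  proof (induction C arbitrary: u u')
    case (Cons a C)
    have "head T a = head T' a"
      using Cons.prems by (cases C) (auto simp: pre_digraph.cas.simps)
    then show ?case using Cons by (auto simp: pre_digraph.cas.simps)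
  qed simp
qed

text \<open>
  A map \<open>\<phi>\<close> with circuit \<open>C\<close> is determined by the vertices along \<open>C\<close> and its values off \<open>C\<close>.
\<close>

lemma card_arc_maps_circuit:
  assumes "finite A" "distinct (map fst C)" "fst ` set C \<subseteq> A"
  shows "card {\<phi> \<in> arc_maps n A. circuit (arc_map_graph n A \<phi>) C}
    \<le> n ^ length C * (n ^ 2) ^ (card A - length C)"
proof -
  let ?T = "\<lambda>\<phi>. traversals (arc_map_graph n A \<phi>)"
  let ?X = "{\<phi> \<in> arc_maps n A. circuit (arc_map_graph n A \<phi>) C}"
  let ?L = "{ws. set ws \<subseteq> {..<n} \<and> length ws = length C}"
  define B where "B = A - fst ` set C"
  define g where "g = (\<lambda>\<phi>. (map (tail (?T \<phi>)) C, restrict \<phi> B))"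
  have [simp]: "finite B" "B \<subseteq> A" using assms by (auto simp: B_def)
  have "card (fst ` set C) = length C"
    using assms(2) distinct_card[of "map fst C"] by simp
  then have cardB: "card B = card A - length C"
    using assms by (simp add: B_def card_Diff_subset)
  have "g ` ?X \<subseteq> ?L \<times> arc_maps n B"
  proof (rule image_subsetI)
    fix \<phi> assume "\<phi> \<in> ?X"
    then have \<phi>: "\<phi> \<in> arc_maps n A" by simp
    then have ends: "fst (\<phi> e) < n \<and> snd (\<phi> e) < n" if "e \<in> A" for e
      using that unfolding arc_maps_def by (metis PiE_mem lessThan_iff mem_Times_iff)
    have "tail (?T \<phi>) x < n" if "x \<in> set C" for x
      using ends[of "fst x"] that assms(3)
      by (cases x) (auto simp: arc_map_graph_def)
    moreover have "restrict \<phi> B \<in> arc_maps n B"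
      unfolding arc_maps_def restrict_PiE_iff
      using PiE_mem[OF \<phi>[unfolded arc_maps_def]] \<open>B \<subseteq> A\<close> by blast
    ultimately show "g \<phi> \<in> ?L \<times> arc_maps n B" by (auto simp: g_def)
  qed
  moreover have "inj_on g ?X"
  proof (rule inj_onI)
    fix \<phi> \<psi> assume *: "\<phi> \<in> ?X" "\<psi> \<in> ?X" "g \<phi> = g \<psi>"
    obtain u v where cas: "pre_digraph.cas (?T \<phi>) u C u" "pre_digraph.cas (?T \<psi>) v C v"
      using * by (auto simp: circuit_def pre_digraph.cycle_def pre_digraph.awalk_def)
    have eq: "map (tail (?T \<phi>)) C = map (tail (?T \<psi>)) C" "restrict \<phi> B = restrict \<psi> B"
      using *(3) by (auto simp: g_def)
    have "C \<noteq> []" using * circuit_nonempty by blast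
    \<comment> \<open>A circuit ends where it starts, so the list of tails already records the end
      of the walk.\<close>
    then have "u = tail (?T \<phi>) (hd C)" "v = tail (?T \<psi>) (hd C)"
      using cas by (cases C; simp add: pre_digraph.cas.simps)+
    then have "u = v" using eq(1) \<open>C \<noteq> []\<close> by (cases C) auto
    have on_C: "\<phi> e = \<psi> e" if "(e, b) \<in> set C" for e b
      using cas_eq_tails_imp_eq[OF cas(1) cas(2)[folded \<open>u = v\<close>] eq(1) that]
      by (auto simp: arc_map_graph_def prod_eq_iff split: if_splits)
    have "\<phi> e = \<psi> e" if "e \<in> A" for e
    proof (cases "e \<in> B")
      case True
      then show ?thesis using eq(2) by (metis restrict_apply')
    next
      case False
      then show ?thesis using on_C that by (auto simp: B_def)
    qed
    then show "\<phi> = \<psi>"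
      using * by (auto simp: arc_maps_def intro: PiE_ext)
  qed
  ultimately have "card ?X \<le> card (?L \<times> arc_maps n B)"
    by (intro card_inj_on_le[of g]) (auto simp: finite_lists_length_eq)
  then show ?thesis
    by (simp add: card_cartesian_product card_lists_length_eq card_arc_maps cardB)
qed

text \<open>A circuit is counted once for every starting point and direction. This is harmless, as
  only upper bounds are needed.\<close>

definition short_circuits :: "nat \<Rightarrow> ('a, 'b) pre_digraph \<Rightarrow> ('b \<times> bool) list set" where
  "short_circuits L G = {C. circuit G C \<and> length C \<le> L}"

lemma finite_short_circuits:
  assumes "finite (arcs G)"
  shows "finite (short_circuits L G)"
proof -
  have "short_circuits L G \<subseteq> {C. set C \<subseteq> arcs G \<times> UNIV \<and> length C \<le> L}"
    using circuit_arcs by (fastforce simp: short_circuits_def)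
  then show ?thesis
    by (rule finite_subset) (intro finite_lists_length_le, use assms in simp)
qed

text \<open>Double counting: there are at most \<open>(2 * D * n) ^ l\<close> candidate lists of
  length \<open>l\<close>, and each is a circuit for at most a fraction \<open>1 / n ^ l\<close> of
  all maps. The powers of \<open>n\<close> cancel.\<close>

lemma sum_card_short_circuits:
  assumes "card A = D * n" "finite A"
  shows "(\<Sum>\<phi>\<in>arc_maps n A. card (short_circuits L (arc_map_graph n A \<phi>)))
    \<le> (\<Sum>l\<le>L. (2 * D) ^ l) * (n ^ 2) ^ card A"
proof -
  let ?G = "arc_map_graph n A"
  define W where "W = (\<lambda>l. {C. set C \<subseteq> A \<times> (UNIV :: bool set) \<and> length C = l \<and> distinct (map fst C)})"
  have fin: "finite (W l)" for l
    unfolding W_def by (rule finite_subset[OF _ finite_lists_length_eq[of "A \<times> UNIV" l]])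
      (use assms in auto)
  have cardW: "card (W l) \<le> (2 * card A) ^ l" for l
  proof -
    have "card (W l) \<le> card {C. set C \<subseteq> A \<times> (UNIV :: bool set) \<and> length C = l}"
      unfolding W_def by (intro card_mono finite_lists_length_eq) (use assms in auto)
    then show ?thesis using assms by (simp add: card_lists_length_eq card_cartesian_product mult.commute)
  qed
  have step: "(\<Sum>C\<in>W l. card {\<phi> \<in> arc_maps n A. circuit (?G \<phi>) C})
      \<le> (2 * D) ^ l * (n ^ 2) ^ card A" for l
  \<comment> \<open>A list of \<open>l\<close> distinct arcs forces \<open>l \<le> card A\<close>,
    so the subtraction \<open>card A - l\<close> does not truncate; without such a list the sum is
    empty.\<close>
  proof (cases "W l = {}")
    case False
    then obtain C where C: "set C \<subseteq> A \<times> (UNIV :: bool set)" "length C = l" "distinct (map fst C)"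
      unfolding W_def by blast
    have "l = card (fst ` set C)" using C distinct_card[of "map fst C"] by simp
    also have "\<dots> \<le> card A" using C assms by (intro card_mono) auto
    finally have l: "l \<le> card A" .
    have "(\<Sum>C\<in>W l. card {\<phi> \<in> arc_maps n A. circuit (?G \<phi>) C})
        \<le> (\<Sum>C\<in>W l. n ^ l * (n ^ 2) ^ (card A - l))"
    proof (rule sum_mono)
      fix C assume "C \<in> W l"
      then show "card {\<phi> \<in> arc_maps n A. circuit (?G \<phi>) C} \<le> n ^ l * (n ^ 2) ^ (card A - l)"
        using card_arc_maps_circuit[of A C n] assms(2) by (force simp: W_def)
    qed
    also have "\<dots> \<le> (2 * (D * n)) ^ l * (n ^ l * (n ^ 2) ^ (card A - l))"
      using cardW[of l] assms(1) by (simp add: mult_right_mono)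
    also have "\<dots> = (2 * D) ^ l * ((n ^ 2) ^ l * (n ^ 2) ^ (card A - l))"
      by (simp add: power_mult_distrib power2_eq_square)
    also have "\<dots> = (2 * D) ^ l * (n ^ 2) ^ card A"
      using l by (simp flip: power_add)
    finally show ?thesis .
  qed simp
  have "(\<Sum>\<phi>\<in>arc_maps n A. card (short_circuits L (?G \<phi>)))
      \<le> (\<Sum>\<phi>\<in>arc_maps n A. \<Sum>l\<le>L. card {C \<in> W l. circuit (?G \<phi>) C})"
  proof (rule sum_mono)
    fix \<phi>
    have "short_circuits L (?G \<phi>) \<subseteq> (\<Union>l\<le>L. {C \<in> W l. circuit (?G \<phi>) C})"
      using circuit_arcs[of "?G \<phi>"]
      by (fastforce simp: short_circuits_def W_def circuit_def arc_map_graph_def)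
    then have "card (short_circuits L (?G \<phi>)) \<le> card (\<Union>l\<le>L. {C \<in> W l. circuit (?G \<phi>) C})"
      by (rule card_mono[rotated]) (use fin in auto)
    also have "\<dots> \<le> (\<Sum>l\<le>L. card {C \<in> W l. circuit (?G \<phi>) C})"
      by (rule card_UN_le) simp
    finally show "card (short_circuits L (?G \<phi>)) \<le> (\<Sum>l\<le>L. card {C \<in> W l. circuit (?G \<phi>) C})" .
  qed
  also have "\<dots> = (\<Sum>l\<le>L. \<Sum>\<phi>\<in>arc_maps n A. card {C \<in> W l. circuit (?G \<phi>) C})"
    by (rule sum.swap)
  also have "\<dots> = (\<Sum>l\<le>L. \<Sum>C\<in>W l. card {\<phi> \<in> arc_maps n A. circuit (?G \<phi>) C})"
    by (intro sum.cong sum_multicount_gen) (use fin assms in auto)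
  also have "\<dots> \<le> (\<Sum>l\<le>L. (2 * D) ^ l * (n ^ 2) ^ card A)"
    by (rule sum_mono) (rule step)
  finally show ?thesis by (simp add: sum_distrib_right)
qed

section \<open>Colourings with few monochromatic arcs\<close>

text \<open>By pigeonhole some colour class has at least \<open>q\<close> vertices, and all ordered
  pairs within it are monochromatic.\<close>

lemma card_bichromatic_pairs:
  fixes c :: "nat \<Rightarrow> nat"
  assumes "c ` {..<k * q} \<subseteq> {..<k}" "k > 0"
  shows "card {(a, b) \<in> {..<k * q} \<times> {..<k * q}. c a \<noteq> c b} \<le> (k * q) ^ 2 - q ^ 2"
proof -
  let ?V = "{..<k * q}"
  have "\<exists>i<k. q \<le> card {a \<in> ?V. c a = i}"
  proof (rule ccontr)
    assume "\<not> ?thesis"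
    then have small: "card {a \<in> ?V. c a = i} < q" if "i < k" for i using that by (meson not_le)
    have "k * q = card (\<Union>i<k. {a \<in> ?V. c a = i})"
      using assms(1) by (subst arg_cong[of _ ?V card]) auto
    also have "\<dots> \<le> (\<Sum>i<k. card {a \<in> ?V. c a = i})" by (rule card_UN_le) simp
    also have "\<dots> < (\<Sum>i<k. q)"
      by (rule sum_strict_mono) (use small assms(2) in auto)
    finally show False by simp
  qed
  then obtain i where i: "q \<le> card {a \<in> ?V. c a = i}" by blast
  let ?M = "{a \<in> ?V. c a = i} \<times> {a \<in> ?V. c a = i}"
  have "card {(a, b) \<in> ?V \<times> ?V. c a \<noteq> c b} \<le> card (?V \<times> ?V - ?M)"
    by (rule card_mono) auto
  also have "\<dots> = (k * q) ^ 2 - card ?M"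
    by (subst card_Diff_subset) (auto simp: card_cartesian_product power2_eq_square)
  also have "\<dots> \<le> (k * q) ^ 2 - q ^ 2"
    using i by (intro diff_le_mono2) (simp add: card_cartesian_product power2_eq_square mult_le_mono)
  finally show ?thesis .
qed

text \<open>If this fails, deleting any \<open>s\<close> arcs leaves a graph without a proper
  \<open>k\<close>-colouring. The exact size of \<open>R\<close> and the extensional
  \<open>c\<close> make the choices easy to count.\<close>

definition almost_colourable :: "nat \<Rightarrow> nat \<Rightarrow> ('a, 'b) pre_digraph \<Rightarrow> bool" where
  "almost_colourable k s G \<longleftrightarrow>
     (\<exists>c \<in> verts G \<rightarrow>\<^sub>E {..<k}. \<exists>R \<subseteq> arcs G. card R = s \<and>
        (\<forall>e \<in> arcs G - R. c (tail G e) \<noteq> c (head G e)))"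

text \<open>A union bound over the colouring \<open>c\<close> and the exceptional set
  \<open>R\<close>: arcs in \<open>R\<close> are free, and every other arc must take a bichromatic
  pair.\<close>

lemma card_almost_colourable:
  assumes "finite A" "k > 0" "s \<le> card A" "n = k * q"
  shows "card {\<phi> \<in> arc_maps n A. almost_colourable k s (arc_map_graph n A \<phi>)}
    \<le> k ^ n * card A ^ s * ((n ^ 2) ^ s * (n ^ 2 - q ^ 2) ^ (card A - s))"
proof -
  let ?c = "{..<n} \<rightarrow>\<^sub>E {..<k}" and ?R = "{R. R \<subseteq> A \<and> card R = s}"
  let ?B = "\<lambda>c :: nat \<Rightarrow> nat. {(a, b) \<in> {..<n} \<times> {..<n}. c a \<noteq> c b}"
  let ?Y = "\<lambda>(c, R). PiE A (\<lambda>e. if e \<in> R then {..<n} \<times> {..<n} else ?B c)"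
  let ?b = "(n ^ 2) ^ s * (n ^ 2 - q ^ 2) ^ (card A - s)"
  have finR: "finite ?R" by (rule finite_subset[of _ "Pow A"]) (use assms in auto)
  have finC: "finite ?c" by (intro finite_PiE) auto
  have finB: "finite (?B c)" for c by (rule finite_subset[of _ "{..<n} \<times> {..<n}"]) auto
  have finY: "finite (?Y x)" for x
    using finB assms(1) by (cases x) (auto intro!: finite_PiE)
  have cardY: "card (?Y (c, R)) \<le> ?b" if "c \<in> ?c" "R \<in> ?R" for c R
  proof -
    have R: "R \<subseteq> A" "card R = s" "finite R" using that assms(1) by (auto intro: finite_subset)
    have "card (?Y (c, R)) = (\<Prod>e\<in>A. card (if e \<in> R then {..<n} \<times> {..<n} else ?B c))"
      using assms(1) by (simp add: card_PiE)
    also have "\<dots> = (\<Prod>e\<in>A. if e \<in> R then n ^ 2 else card (?B c))"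
      by (intro prod.cong) (auto simp: card_cartesian_product power2_eq_square)
    also have "\<dots> = (\<Prod>e\<in>A \<inter> R. n ^ 2) * (\<Prod>e\<in>A - R. card (?B c))"
      using assms(1) by (simp add: prod.If_cases Diff_eq)
    also have "\<dots> = (n ^ 2) ^ s * card (?B c) ^ (card A - s)"
      using R by (simp add: Int_absorb1 card_Diff_subset)
    also have "\<dots> \<le> ?b"
      using card_bichromatic_pairs[of c k q] that(1) assms
      by (intro mult_left_mono power_mono) (auto simp: PiE_iff image_subset_iff)
    finally show ?thesis .
  qed
  have "{\<phi> \<in> arc_maps n A. almost_colourable k s (arc_map_graph n A \<phi>)} \<subseteq> (\<Union>x\<in>?c \<times> ?R. ?Y x)"
  proof
    fix \<phi> assume "\<phi> \<in> {\<phi> \<in> arc_maps n A. almost_colourable k s (arc_map_graph n A \<phi>)}"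
    then have \<phi>: "\<phi> \<in> arc_maps n A" and "almost_colourable k s (arc_map_graph n A \<phi>)"
      by simp_all
    then obtain c R where cR: "c \<in> ?c" "R \<in> ?R"
      and c: "\<forall>e \<in> A - R. c (fst (\<phi> e)) \<noteq> c (snd (\<phi> e))"
      by (auto simp: almost_colourable_def arc_map_graph_def)
    have "\<phi> e \<in> (if e \<in> R then {..<n} \<times> {..<n} else ?B c)" if "e \<in> A" for e
    proof -
      have "\<phi> e \<in> {..<n} \<times> {..<n}" using \<phi> that unfolding arc_maps_def by (rule PiE_mem)
      moreover have "c (fst (\<phi> e)) \<noteq> c (snd (\<phi> e))" if "e \<notin> R"
        using c that \<open>e \<in> A\<close> by blast
      ultimately show ?thesis by (simp add: case_prod_unfold mem_Times_iff)
    qed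
    moreover have "\<phi> \<in> extensional A" using \<phi> by (simp add: arc_maps_def PiE_iff)
    ultimately have "\<phi> \<in> ?Y (c, R)" by (simp add: PiE_iff)
    then show "\<phi> \<in> (\<Union>x\<in>?c \<times> ?R. ?Y x)" using cR by blast
  qed
  then have "card {\<phi> \<in> arc_maps n A. almost_colourable k s (arc_map_graph n A \<phi>)}
      \<le> card (\<Union>x\<in>?c \<times> ?R. ?Y x)"
    by (rule card_mono[rotated]) (use finY finR finC in blast)
  also have "\<dots> \<le> (\<Sum>x\<in>?c \<times> ?R. card (?Y x))"
    by (rule card_UN_le) (use finR finC in blast)
  also have "\<dots> \<le> (\<Sum>x\<in>?c \<times> ?R. ?b)"
    by (rule sum_mono) (use cardY in auto)
  also have "\<dots> = k ^ n * (card A choose s) * ?b"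
    using assms(1) by (simp add: card_cartesian_product card_PiE n_subsets)
  also have "\<dots> \<le> k ^ n * card A ^ s * ?b"
    using binomial_le_pow[OF assms(3)] by (intro mult_right_mono mult_left_mono) auto
  finally show ?thesis .
qed

section \<open>Asymptotic estimates\<close>

lemma eventually_power_less_exp:
  assumes "c > 0"
  shows "\<forall>\<^sub>F n in sequentially. c * real n ^ s < 2 ^ n"
proof -
  have "filterlim (\<lambda>n. real n * ln 2) at_top sequentially"
    by (rule filterlim_at_top_mult_tendsto_pos[OF tendsto_const _ filterlim_real_sequentially]) simp
  from filterlim_compose[OF tendsto_power_div_exp_0 this]
  have "(\<lambda>n. (real n * ln 2) ^ s / exp (real n * ln 2)) \<longlonglongrightarrow> 0" by simp
  then have "\<forall>\<^sub>F n in sequentially. (real n * ln 2) ^ s / exp (real n * ln 2) < ln 2 ^ s / c"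
    by (rule order_tendstoD) (use assms in simp)
  then show ?thesis
  proof eventually_elim
    case (elim n)
    have "exp (real n * ln 2) = 2 ^ n" by (simp add: exp_of_nat_mult)
    then show ?case using elim assms by (simp add: power_mult_distrib field_simps)
  qed
qed

text \<open>At most a fraction \<open>\<rho>\<close> of the pairs is bichromatic. Once
  \<open>\<rho> ^ D < 1 / (2 * k)\<close>, the \<open>k ^ n\<close> colourings are outweighed by a
  factor \<open>2 ^ n\<close>, which also beats the polynomial terms. \<open>D\<close> is chosen
  before \<open>s\<close> because \<open>s\<close> will be computed from \<open>D\<close>; taking
  \<open>n = k * q\<close> avoids rounding.\<close>

lemma colouring_bound:
  assumes "k > 0"
  shows "\<exists>D. \<forall>s. \<exists>q. s \<le> D * (k * q) \<and>
    2 * (k ^ (k * q) * (D * (k * q)) ^ s *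
      (((k * q) ^ 2) ^ s * ((k * q) ^ 2 - q ^ 2) ^ (D * (k * q) - s)))
    < ((k * q) ^ 2) ^ (D * (k * q))"
proof -
  define \<rho> where "\<rho> = 1 - 1 / real k ^ 2"
  have \<rho>: "0 \<le> \<rho>" "\<rho> < 1" using assms by (simp_all add: \<rho>_def)
  obtain D where D: "\<rho> ^ D < 1 / (2 * real k)"
    using real_arch_pow_inv[of "1 / (2 * real k)" \<rho>] \<rho> assms by auto
  have "D > 0" using D assms by (cases D) auto
  have "\<exists>q. s \<le> D * (k * q) \<and> 2 * (k ^ (k * q) * (D * (k * q)) ^ s *
      (((k * q) ^ 2) ^ s * ((k * q) ^ 2 - q ^ 2) ^ (D * (k * q) - s)))
    < ((k * q) ^ 2) ^ (D * (k * q))" for s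
  proof -
    define c where "c = 2 * (2 * real D * real k) ^ s"
    have "c > 0" using \<open>D > 0\<close> assms by (simp add: c_def)
    then obtain N where N: "\<And>n. n \<ge> N \<Longrightarrow> c * real n ^ s < 2 ^ n"
      using eventually_power_less_exp[of c s] by (auto simp: eventually_sequentially)
    \<comment> \<open>Since \<open>n \<ge> q\<close>, this makes \<open>n\<close> positive and at
      least as large as both \<open>N\<close> and \<open>s\<close>.\<close>
    define q n where "q = N + s + 1" and "n = k * q"
    have "q \<le> n" using assms by (simp add: n_def)
    then have n: "n \<ge> N" "n \<ge> s" "n > 0" by (simp_all add: q_def)
    have "s * 1 \<le> n * D" using n \<open>D > 0\<close> by (intro mult_le_mono) auto
    then have "s \<le> D * n" by (simp add: mult.commute)
    \<comment> \<open>This replaces the exponent by a multiple of \<open>D\<close>, so that the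
      choice of \<open>D\<close> applies to each of \<open>n - s\<close> factors.\<close>
    have "D * (n - s) \<le> D * n - s"
      using \<open>D > 0\<close> by (simp add: diff_mult_distrib2 diff_le_mono2)
    then have "\<rho> ^ (D * n - s) \<le> \<rho> ^ (D * (n - s))"
      using \<rho> by (intro power_decreasing) auto
    also have "\<dots> \<le> (1 / (2 * real k)) ^ (n - s)"
      unfolding power_mult using D \<rho> by (intro power_mono) auto
    also have "\<dots> = (2 * real k) ^ s / (2 * real k) ^ n"
      using n assms by (simp add: power_diff power_divide)
    finally have "2 * (real k ^ n * real (D * n) ^ s * \<rho> ^ (D * n - s))
        \<le> 2 * (real k ^ n * real (D * n) ^ s * ((2 * real k) ^ s / (2 * real k) ^ n))"
      by (intro mult_left_mono) auto
    also have "\<dots> = c * real n ^ s / 2 ^ n"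
      using assms by (simp add: c_def power_mult_distrib field_simps)
    also have "\<dots> < 1" using N[OF n(1)] by simp
    finally have less: "2 * (real k ^ n * real (D * n) ^ s * \<rho> ^ (D * n - s)) < 1" .
    have "q ^ 2 \<le> n ^ 2" using \<open>q \<le> n\<close> by (intro power_mono) auto
    then have "real (n ^ 2 - q ^ 2) = \<rho> * real (n ^ 2)"
      using assms by (simp add: of_nat_diff \<rho>_def n_def field_simps)
    then have "real (2 * (k ^ n * (D * n) ^ s * ((n ^ 2) ^ s * (n ^ 2 - q ^ 2) ^ (D * n - s))))
      = 2 * (real k ^ n * real (D * n) ^ s * \<rho> ^ (D * n - s)) *
        (real (n ^ 2) ^ s * real (n ^ 2) ^ (D * n - s))"
      by (simp only: of_nat_mult of_nat_power power_mult_distrib) simp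
    also have "real (n ^ 2) ^ s * real (n ^ 2) ^ (D * n - s) = real (n ^ 2) ^ (D * n)"
      using \<open>s \<le> D * n\<close> by (simp flip: power_add)
    also have "2 * (real k ^ n * real (D * n) ^ s * \<rho> ^ (D * n - s)) * real (n ^ 2) ^ (D * n)
        < 1 * real (n ^ 2) ^ (D * n)"
      by (rule mult_strict_right_mono[OF less]) (use n in simp)
    also have "\<dots> = real ((n ^ 2) ^ (D * n))" by simp
    finally show ?thesis
      using \<open>s \<le> D * n\<close> unfolding n_def of_nat_less_iff by blast
  qed
  then show ?thesis by blast
qed

section \<open>Averaging and deletion\<close>

lemma exists_few_short_circuits_not_almost_colourable:
  assumes "k > 0"
  shows "\<exists>n A s. \<exists>\<phi> \<in> arc_maps n A. finite A \<and> s \<le> card A \<and>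
    card (short_circuits L (arc_map_graph n A \<phi>)) \<le> s \<and>
    \<not> almost_colourable k s (arc_map_graph n (A :: nat set) \<phi>)"
proof -
  obtain D where D: "\<And>s. \<exists>q. s \<le> D * (k * q) \<and> 2 * (k ^ (k * q) * (D * (k * q)) ^ s *
      (((k * q) ^ 2) ^ s * ((k * q) ^ 2 - q ^ 2) ^ (D * (k * q) - s)))
    < ((k * q) ^ 2) ^ (D * (k * q))"
    using colouring_bound[OF assms] by blast
  define K where "K = (\<Sum>l\<le>L. (2 * D) ^ l)"
  \<comment> \<open>Twice the bound on the average number of short circuits. By Markov's inequality
    fewer than half of the maps exceed it, and fewer than half are almost colourable, so some map
    avoids both.\<close>
  define s where "s = 2 * K"
  obtain q where q: "s \<le> D * (k * q)" "2 * (k ^ (k * q) * (D * (k * q)) ^ s *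
      (((k * q) ^ 2) ^ s * ((k * q) ^ 2 - q ^ 2) ^ (D * (k * q) - s)))
    < ((k * q) ^ 2) ^ (D * (k * q))"
    using D[of s] by blast
  define n where "n = k * q"
  define A where "A = {..<D * n}"
  define N where "N = (n ^ 2) ^ card A"
  have A: "finite A" "card A = D * n" by (simp_all add: A_def)
  let ?G = "arc_map_graph n A"
  let ?many = "{\<phi> \<in> arc_maps n A. s < card (short_circuits L (?G \<phi>))}"
  let ?col = "{\<phi> \<in> arc_maps n A. almost_colourable k s (?G \<phi>)}"
  have col: "2 * card ?col < N"
    using card_almost_colourable[OF A(1) assms, of s n q] q
    unfolding N_def A(2) n_def by linarith
  \<comment> \<open>Exceeding \<open>s\<close> means at least \<open>s + 1\<close> short circuits;
    this extra 1 makes the bound by one half strict.\<close>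
  have "card ?many * (s + 1) = (\<Sum>\<phi>\<in>?many. s + 1)" by simp
  also have "\<dots> \<le> (\<Sum>\<phi>\<in>?many. card (short_circuits L (?G \<phi>)))"
    by (rule sum_mono) simp
  also have "\<dots> \<le> (\<Sum>\<phi>\<in>arc_maps n A. card (short_circuits L (?G \<phi>)))"
    by (rule sum_mono2) (use A in auto)
  also have "\<dots> \<le> K * N"
    using sum_card_short_circuits[OF A(2,1), of L] by (simp add: K_def N_def)
  finally have "card ?many * (s + 1) \<le> K * N" .
  from mult_le_mono2[OF this, of 2] have "2 * card ?many * (s + 1) \<le> N * s"
    by (simp only: s_def mult_ac)
  also have "\<dots> < N * (s + 1)" using col by simp
  finally have "2 * card ?many < N"
    by (rule mult_less_cancel2[THEN iffD1, THEN conjunct2])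
  then have "card (?many \<union> ?col) < card (arc_maps n A)"
    using col card_Un_le[of ?many ?col] A by (simp add: card_arc_maps N_def)
  then have "\<not> arc_maps n A \<subseteq> ?many \<union> ?col"
    using card_mono[of "?many \<union> ?col" "arc_maps n A"] A by fastforce
  then obtain \<phi> where "\<phi> \<in> arc_maps n A" "card (short_circuits L (?G \<phi>)) \<le> s"
    "\<not> almost_colourable k s (?G \<phi>)" by fastforce
  then show ?thesis using A q(1) n_def by metis
qed

lemma exists_large_girth_not_colourable:
  fixes k :: nat
  assumes "k > 0"
  shows "\<exists>G :: (nat, nat) pre_digraph. fin_digraph G \<and> (\<forall>C. circuit G C \<longrightarrow> L < length C) \<and>
    (\<forall>c. c ` verts G \<subseteq> {..<k} \<longrightarrow> (\<exists>e \<in> arcs G. c (tail G e) = c (head G e)))"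
proof -
  obtain n s and A :: "nat set" and \<phi> where \<phi>: "\<phi> \<in> arc_maps n A" and A: "finite A" "s \<le> card A"
    and few: "card (short_circuits L (arc_map_graph n A \<phi>)) \<le> s"
    and col: "\<not> almost_colourable k s (arc_map_graph n A \<phi>)"
    using exists_few_short_circuits_not_almost_colourable[OF assms, of L] by blast
  define G where "G = arc_map_graph n A \<phi>"
  have [simp]: "arcs G = A" "verts G = {..<n}" by (simp_all add: G_def arc_map_graph_def)
  \<comment> \<open>One arc from each short circuit; deleting these destroys all of them.\<close>
  let ?R = "(\<lambda>C. fst (hd C)) ` short_circuits L G"
  have fin: "finite (short_circuits L G)" using finite_short_circuits[of G L] A by simp
  have "fst (hd C) \<in> A" if "circuit G C" for C
    using circuit_arcs[OF that, of "fst (hd C)" "snd (hd C)"] circuit_nonempty[OF that] by simp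
  then have "?R \<subseteq> A" by (auto simp: short_circuits_def)
  moreover have "card ?R \<le> s" using card_image_le[OF fin] few le_trans unfolding G_def by blast
  \<comment> \<open>The deleted set is padded to exactly \<open>s\<close> arcs, as
    \<open>almost_colourable\<close> requires; further deletions create no circuits.\<close>
  ultimately obtain R where R: "?R \<subseteq> R" "R \<subseteq> A" "card R = s"
    using exists_subset_between[of ?R s A] A by blast
  let ?G = "G\<lparr>arcs := A - R\<rparr>"
  have "fst (\<phi> e) < n \<and> snd (\<phi> e) < n" if "e \<in> A" for e
    using PiE_mem[OF \<phi>[unfolded arc_maps_def] that] by (simp add: mem_Times_iff)
  then have "fin_digraph ?G"
    using A by unfold_locales (auto simp: G_def arc_map_graph_def)
  moreover have "L < length C" if C: "circuit ?G C" for C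
  proof (rule ccontr)
    assume "\<not> L < length C"
    moreover have "circuit G C" using circuit_arcs_update[OF C, of A] by (simp add: G_def arc_map_graph_def)
    ultimately have "fst (hd C) \<in> R" using R(1) by (auto simp: short_circuits_def)
    then show False
      using circuit_arcs[OF C, of "fst (hd C)" "snd (hd C)"] circuit_nonempty[OF C] by simp
  qed
  moreover have "\<exists>e \<in> arcs ?G. c (tail ?G e) = c (head ?G e)" if "c ` verts ?G \<subseteq> {..<k}" for c
  proof (rule ccontr)
    assume no: "\<not> ?thesis"
    define c' where "c' = restrict c (verts G)"
    have "c' \<in> verts G \<rightarrow>\<^sub>E {..<k}" using that by (auto simp: c'_def)
    moreover have "\<forall>e \<in> arcs G - R. c' (tail G e) \<noteq> c' (head G e)"
    proof
      fix e assume e: "e \<in> arcs G - R"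
      then have "tail G e \<in> verts G" "head G e \<in> verts G"
        using wf_digraph.wellformed[of ?G e] \<open>fin_digraph ?G\<close> by (simp_all add: fin_digraph_def)
      then show "c' (tail G e) \<noteq> c' (head G e)" using no e by (simp add: c'_def)
    qed
    moreover have "R \<subseteq> arcs G" using R(2) by simp
    ultimately have "almost_colourable k s G"
      unfolding almost_colourable_def using R(3) by blast
    then show False using col by (simp add: G_def)
  qed
  ultimately show ?thesis by blast
qed

section \<open>Tension-continuous maps\<close>

text \<open>
  Greedy colouring: an element \<open>b\<close> conflicts only with \<open>b + x\<close> and \<open>b - x\<close>.
\<close>

lemma exists_three_colouring_translation:
  fixes x :: "'m::ab_group_add"
  assumes "finite S" "x \<noteq> 0"
  shows "\<exists>g. range g \<subseteq> {..<3::nat} \<and> (\<forall>a\<in>S. a + x \<in> S \<longrightarrow> g a \<noteq> g (a + x))"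
  using assms(1)
proof (induction S)
  case empty
  show ?case by (intro exI[of _ "\<lambda>_. 0"]) auto
next
  case (insert b S)
  then obtain g where g: "range g \<subseteq> {..<3::nat}" "\<And>a. a \<in> S \<Longrightarrow> a + x \<in> S \<Longrightarrow> g a \<noteq> g (a + x)"
    by blast
  have "\<not> {..<3} \<subseteq> {g (b + x), g (b - x)}"
    using card_mono[of "{g (b + x), g (b - x)}" "{..<3::nat}"]
      card_insert_le_m1[of 2 "{g (b - x)}" "g (b + x)"] by auto
  then obtain i where i: "i < 3" "i \<noteq> g (b + x)" "i \<noteq> g (b - x)" by blast
  have "(g(b := i)) a \<noteq> (g(b := i)) (a + x)" if "a \<in> insert b S" "a + x \<in> insert b S" for a
  proof (cases "a = b")
    case True
    then show ?thesis using i \<open>x \<noteq> 0\<close> by simp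
  next
    case False
    then show ?thesis using g(2)[of a] i that by (cases "a + x = b") (auto simp: algebra_simps)
  qed
  then show ?case using g(1) i(1) by (intro exI[of _ "g(b := i)"]) auto
qed

text \<open>For each vertex \<open>v\<close> of \<open>H\<close>, the cut at \<open>v\<close> pulls
  back to a potential \<open>p v\<close> on \<open>G\<close>. Along an arc whose image has head
  \<open>v\<close>, this potential grows by \<open>x\<close>, so a colouring of its values that
  separates \<open>a\<close> from \<open>a + x\<close> distinguishes the ends. Combining these
  colourings over all \<open>v\<close> serves every arc.\<close>

lemma tension_le_imp_colouring:
  fixes x :: "'m::ab_group_add" and G :: "('a, 'b) pre_digraph"
  assumes "tension_le TYPE('m) G H" "x \<noteq> 0" "fin_digraph G" "fin_digraph H"
    and loopless: "\<And>e. e \<in> arcs H \<Longrightarrow> tail H e \<noteq> head H e"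
  shows "\<exists>c :: 'a \<Rightarrow> nat. c ` verts G \<subseteq> {..<3 ^ card (verts H)} \<and>
    (\<forall>e \<in> arcs G. c (tail G e) \<noteq> c (head G e))"
proof -
  interpret G: fin_digraph G by fact
  interpret H: fin_digraph H by fact
  obtain f where f: "f \<in> arcs G \<rightarrow> arcs H"
    "\<And>\<tau> :: _ \<Rightarrow> 'm. tension H \<tau> \<Longrightarrow> tension G (\<tau> \<circ> f)"
    using assms(1) by (auto simp: tension_le_def tension_continuous_def)
  define cut where "cut = (\<lambda>v. potential_diff H (\<lambda>w. if w = v then x else 0))"
  have "\<exists>p. \<forall>e\<in>arcs G. cut v (f e) = potential_diff G p e" for v
    using tension_potential[OF G.wf_digraph, of "arcs G" "cut v \<circ> f"] f(2)[of "cut v"]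
    by (simp add: cut_def tension_potential_diff)
  then obtain p where p: "\<And>v e. e \<in> arcs G \<Longrightarrow> cut v (f e) = potential_diff G (p v) e"
    by metis
  have "\<exists>g. range g \<subseteq> {..<3::nat} \<and>
      (\<forall>a\<in>p v ` verts G. a + x \<in> p v ` verts G \<longrightarrow> g a \<noteq> g (a + x))" for v
    by (rule exists_three_colouring_translation) (use \<open>x \<noteq> 0\<close> in auto)
  then obtain g where g: "\<And>v. range (g v) \<subseteq> {..<3::nat}"
    "\<And>v a. a \<in> p v ` verts G \<Longrightarrow> a + x \<in> p v ` verts G \<Longrightarrow> g v a \<noteq> g v (a + x)"
    by metis
  define c where "c = (\<lambda>u. \<lambda>v\<in>verts H. g v (p v u))"
  let ?P = "verts H \<rightarrow>\<^sub>E {..<3::nat}"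
  have "finite ?P" by (intro finite_PiE) auto
  moreover have "card ?P = 3 ^ card (verts H)" by (simp add: card_PiE)
  \<comment> \<open>\<open>h\<close> numbers the tuples of colours, turning the product colouring
    into one by natural numbers.\<close>
  ultimately obtain h where h: "bij_betw h ?P {..<3 ^ card (verts H) :: nat}"
    by (metis ex_bij_betw_finite_nat atLeast0LessThan)
  have cP: "c u \<in> ?P" for u using g(1) by (auto simp: c_def)
  have proper: "c (tail G e) \<noteq> c (head G e)" if e: "e \<in> arcs G" for e
  proof
    assume eq: "c (tail G e) = c (head G e)"
    \<comment> \<open>The coordinate in which the ends of \<open>e\<close> differ:
      \<open>cut v\<close> takes the value \<open>x\<close> at \<open>f e\<close>, because
      \<open>f e\<close> is not a loop.\<close>
    define v where "v = head H (f e)"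
    have fe: "f e \<in> arcs H" using f(1) e by blast
    then have "v \<in> verts H" by (simp add: v_def)
    then have "g v (p v (tail G e)) = g v (p v (head G e))"
      using fun_cong[OF eq, of v] by (simp add: c_def)
    moreover have "p v (head G e) = p v (tail G e) + x"
      using p[OF e, of v] loopless[OF fe] by (simp add: cut_def potential_diff_def v_def algebra_simps)
    moreover have "p v (tail G e) \<in> p v ` verts G" "p v (head G e) \<in> p v ` verts G"
      using e by auto
    ultimately show False using g(2)[of "p v (tail G e)" v] by simp
  qed
  have "(h \<circ> c) ` verts G \<subseteq> {..<3 ^ card (verts H)}"
    using bij_betwE[OF h] cP by auto
  moreover have "\<forall>e\<in>arcs G. (h \<circ> c) (tail G e) \<noteq> (h \<circ> c) (head G e)"
    using proper inj_on_contraD[OF bij_betw_imp_inj_on[OF h] _ cP cP] by simp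
  ultimately show ?thesis by blast
qed

section \<open>The order and its extreme graphs\<close>

lemma tension_le_trans:
  assumes "tension_le TYPE('m::ab_group_add) G H" "tension_le TYPE('m) H K"
  shows "tension_le TYPE('m) G K"
proof -
  obtain f g where f: "f \<in> arcs G \<rightarrow> arcs H" "\<And>\<tau> :: _ \<Rightarrow> 'm. tension H \<tau> \<Longrightarrow> tension G (\<tau> \<circ> f)"
    and g: "g \<in> arcs H \<rightarrow> arcs K" "\<And>\<tau> :: _ \<Rightarrow> 'm. tension K \<tau> \<Longrightarrow> tension H (\<tau> \<circ> g)"
    using assms by (auto simp: tension_le_def tension_continuous_def)
  have "tension G (\<tau> \<circ> (g \<circ> f))" if "tension K \<tau>" for \<tau> :: "_ \<Rightarrow> 'm"
    using f(2)[OF g(2)[OF that]] by (simp add: comp_assoc)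
  then have "tension_continuous TYPE('m) G K (g \<circ> f)"
    using f(1) g(1) by (auto simp: tension_continuous_def)
  then show ?thesis by (auto simp: tension_le_def)
qed

lemma tension_le_arcless:
  assumes "arcs G = {}"
  shows "tension_le TYPE('m::ab_group_add) G H"
proof -
  have "\<not> circuit G C" for C
    using circuit_arcs[of G C "fst (hd C)" "snd (hd C)"] circuit_nonempty[of G C] assms by auto
  then show ?thesis using assms by (auto simp: tension_le_def tension_continuous_def tension_def)
qed

text \<open>Tensions vanish on a loop, so sending every arc to it pulls each tension back to
  zero.\<close>

lemma tension_le_loop:
  assumes "wf_digraph H" "e \<in> arcs H" "tail H e = head H e"
  shows "tension_le TYPE('m::ab_group_add) G H"
proof -
  have "tension G (\<tau> \<circ> (\<lambda>_. e))" if "tension H \<tau>" for \<tau> :: "_ \<Rightarrow> 'm"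
    using tension_loop[OF that assms] by (simp add: comp_def tension_zero)
  then show ?thesis using assms by (auto simp: tension_le_def tension_continuous_def)
qed

text \<open>With a single arc and no repetition a circuit would have length 1, but the arc has two
  different ends.\<close>

lemma not_circuit_K2: "\<not> circuit graph_K2 C"
proof
  assume C: "circuit graph_K2 C"
  obtain a D where D: "C = a # D" using circuit_nonempty[OF C] by (cases C) auto
  have "fst x = 0" if "x \<in> set C" for x
    using circuit_arcs[OF C, of "fst x" "snd x"] that by (simp add: graph_K2_def)
  moreover have "distinct (map fst C)" using C by (simp add: circuit_def)
  ultimately have "D = []" using D by (cases D) auto
  then show False using C D
    by (cases a) (auto simp: circuit_def pre_digraph.cycle_def pre_digraph.awalk_def
        pre_digraph.cas.simps graph_K2_def split: if_splits)
qed

lemma K2_tension_le: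
  assumes "arcs G \<noteq> {}"
  shows "tension_le TYPE('m::ab_group_add) graph_K2 G"
proof -
  obtain e where "e \<in> arcs G" using assms by blast
  then have "tension_continuous TYPE('m) graph_K2 G (\<lambda>_. e)"
    by (simp add: tension_continuous_def tension_def not_circuit_K2)
  then show ?thesis by (auto simp: tension_le_def)
qed

text \<open>Every function pulled back from a single arc is constant.\<close>

lemma tension_le_K2I:
  fixes F :: "('a, 'b) pre_digraph"
  assumes "\<And>m :: 'm::ab_group_add. tension F (\<lambda>_. m)"
  shows "tension_le TYPE('m) F graph_K2"
proof -
  have "tension_continuous TYPE('m) F graph_K2 (\<lambda>_. 0)"
    using assms by (auto simp: tension_continuous_def graph_K2_def comp_def)
  then show ?thesis by (auto simp: tension_le_def)
qed

text \<open>The image of \<open>F\<close> has fewer arcs than any circuit of \<open>G\<close>, so a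
  constant is vacuously a tension on it and has a potential there. The differences of this potential
  form a tension on all of \<open>G\<close>, whose pullback is the constant on
  \<open>F\<close>.\<close>

lemma tension_le_large_girth:
  fixes F :: "('a, 'b) pre_digraph" and G :: "('c, 'd) pre_digraph"
  assumes "tension_le TYPE('m::ab_group_add) F G" "fin_digraph F" "fin_digraph G"
    and girth: "\<And>C. circuit G C \<Longrightarrow> card (arcs F) < length C"
  shows "tension_le TYPE('m) F graph_K2"
proof (rule tension_le_K2I)
  interpret F: fin_digraph F by fact
  interpret G: fin_digraph G by fact
  fix m :: 'm
  obtain f where f: "f \<in> arcs F \<rightarrow> arcs G" "\<And>\<tau> :: _ \<Rightarrow> 'm. tension G \<tau> \<Longrightarrow> tension F (\<tau> \<circ> f)"
    using assms(1) by (auto simp: tension_le_def tension_continuous_def)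
  define A where "A = f ` arcs F"
  have A: "finite A" "A \<subseteq> arcs G" using f(1) by (auto simp: A_def)
  have "\<not> circuit (G\<lparr>arcs := A\<rparr>) C" for C
  proof
    assume C: "circuit (G\<lparr>arcs := A\<rparr>) C"
    then have "circuit G C" using circuit_arcs_update[OF C A(2)] by simp
    have "length C = card (fst ` set C)"
      using C distinct_card[of "map fst C"] by (simp add: circuit_def)
    also have "\<dots> \<le> card A" using circuit_arcs[OF C] A by (intro card_mono) force+
    also have "\<dots> \<le> card (arcs F)" unfolding A_def by (rule card_image_le) simp
    finally show False using girth[OF \<open>circuit G C\<close>] by simp
  qed
  then have "tension (G\<lparr>arcs := A\<rparr>) (\<lambda>_. m)" by (simp add: tension_def)
  then obtain p where p: "\<forall>e\<in>A. m = potential_diff G p e"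
    using tension_potential[OF G.wf_digraph A] by blast
  have "tension F (potential_diff G p \<circ> f)" by (intro f(2) tension_potential_diff)
  moreover have "tension F (potential_diff G p \<circ> f) \<longleftrightarrow> tension F (\<lambda>_. m)"
    by (rule tension_cong) (use p in \<open>auto simp: A_def\<close>)
  ultimately show "tension F (\<lambda>_. m)" by simp
qed

theorem theorem20:
  fixes F :: "nat \<Rightarrow> ('a, 'b) pre_digraph"
    and H :: "('c, 'd) pre_digraph"
    and t :: nat
  assumes nontrivial: "\<exists>x :: 'm::ab_group_add. x \<noteq> 0"
    and "t \<ge> 1"
    and "\<And>i. i \<in> {1..t} \<Longrightarrow> fin_digraph (F i)"
    and "fin_digraph H"
    and duality: "\<And>G :: (nat, nat) pre_digraph. fin_digraph G \<Longrightarrow>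
           tension_le TYPE('m) G H \<longleftrightarrow> (\<forall>i\<in>{1..t}. \<not> tension_le TYPE('m) (F i) G)"
  shows "tension_equiv TYPE('m) H graph_K1 \<and>
         (\<exists>i\<in>{1..t}. tension_equiv TYPE('m) (F i) graph_K2)"
proof -
  have K1: "fin_digraph graph_K1" and K2: "fin_digraph graph_K2"
    by (unfold_locales; simp add: graph_K1_def graph_K2_def)+
  have [simp]: "arcs graph_K1 = {}" by (simp add: graph_K1_def)
  have "arcs H = {}"
  proof (rule ccontr)
    assume "arcs H \<noteq> {}"
    then have "tension_le TYPE('m) graph_K2 H" by (rule K2_tension_le)
    then have not_K2: "\<not> tension_le TYPE('m) (F i) graph_K2" if "i \<in> {1..t}" for i
      using duality[OF K2] that by blast
    have loopless: "tail H e \<noteq> head H e" if e: "e \<in> arcs H" for e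
    proof
      assume loop: "tail H e = head H e"
      \<comment> \<open>A single loop lies above every graph, in particular above
        \<open>F 1\<close>. If \<open>H\<close> had a loop, \<open>?O\<close> would also lie below
        \<open>H\<close>, against the duality.\<close>
      let ?O = "\<lparr>verts = {0}, arcs = {0}, tail = (\<lambda>_. 0), head = (\<lambda>_. 0)\<rparr> :: (nat, nat) pre_digraph"
      have O: "fin_digraph ?O" by unfold_locales simp_all
      have "wf_digraph H" using assms(4) by (simp add: fin_digraph_def)
      then have "tension_le TYPE('m) ?O H" using e loop by (rule tension_le_loop)
      moreover have "tension_le TYPE('m) (F 1) ?O"
        by (rule tension_le_loop[of _ 0]) (use O in \<open>simp_all add: fin_digraph_def\<close>)
      ultimately show False using duality[OF O] \<open>t \<ge> 1\<close> by force
    qed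
    \<comment> \<open>One bound for all \<open>F i\<close> at once, since the index with
      \<open>F i\<close> below \<open>G\<close> is known only after \<open>G\<close> is
      chosen.\<close>
    define L where "L = (\<Sum>i\<in>{1..t}. card (arcs (F i)))"
    obtain G :: "(nat, nat) pre_digraph" where G: "fin_digraph G"
      "\<And>C. circuit G C \<Longrightarrow> L < length C"
      "\<And>c. c ` verts G \<subseteq> {..<3 ^ card (verts H) :: nat} \<Longrightarrow> \<exists>e \<in> arcs G. c (tail G e) = c (head G e)"
      using exists_large_girth_not_colourable[of "3 ^ card (verts H)" L] by auto
    obtain x :: 'm where "x \<noteq> 0" using nontrivial by blast
    have "\<not> tension_le TYPE('m) G H"
      using tension_le_imp_colouring[OF _ \<open>x \<noteq> 0\<close> G(1) assms(4) loopless] G(3) by blast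
    then obtain i where i: "i \<in> {1..t}" "tension_le TYPE('m) (F i) G"
      using duality[OF G(1)] by blast
    have "card (arcs (F i)) \<le> L" unfolding L_def using i(1) by (intro member_le_sum) auto
    then have "tension_le TYPE('m) (F i) graph_K2"
      using G(2) by (intro tension_le_large_girth[OF i(2) assms(3)[OF i(1)] G(1)]) fastforce
    then show False using not_K2[OF i(1)] by blast
  qed
  have "\<not> tension_le TYPE('m) graph_K2 H"
    using \<open>arcs H = {}\<close> by (auto simp: tension_le_def tension_continuous_def graph_K2_def)
  then obtain i where i: "i \<in> {1..t}" "tension_le TYPE('m) (F i) graph_K2"
    using duality[OF K2] by blast
  \<comment> \<open>By duality this keeps \<open>F i\<close> from lying below
    \<open>graph_K1\<close>, so \<open>F i\<close> must have an arc.\<close>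
  have "tension_le TYPE('m) graph_K1 H" by (rule tension_le_arcless) simp
  then have "\<not> tension_le TYPE('m) (F i) graph_K1" using duality[OF K1] i(1) by blast
  then have "arcs (F i) \<noteq> {}" using tension_le_arcless by blast
  then have "tension_le TYPE('m) graph_K2 (F i)" by (rule K2_tension_le)
  then show ?thesis
    using i \<open>arcs H = {}\<close> \<open>tension_le TYPE('m) graph_K1 H\<close> tension_le_arcless
    unfolding tension_equiv_def by blast
qed

end
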